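(* Let $F$ be a bounded subset of $\mathbb{R}^2$. Let $\underline{\dim}_B(F)$ and $\overline{\dim}_B(F)$ be the lower and upper box-counting dimensions of $F$, and for $\delta>0$ let $T_\delta(F)$ be the number of $\delta$-mesh triangles that have non-empty intersection with $F$. Then $$\underline{\dim}_B(F) = \liminf_{\delta \to 0^+} \frac{\log T_\delta (F)}{- \log \delta} \qquad\text{and}\qquad \overline{\dim}_B(F) = \limsup_{\delta \to 0^+} \frac{\log T_\delta (F)}{- \log \delta}.$$ Moreover, if the limit exists, then the box-counting dimension of $F$ is $$\dim_B(F) = \lim_{\delta \to 0^+} \frac{\log T_\delta (F)}{- \log \delta}.$$
   Context: For a bounded set $F\subset\mathbb{R}^n$ and $\delta>0$, $N_\delta(F)$ denotes the smallest number of boxes (cubes; squares when $n=2$) of side length $\delta$ needed to cover $F$. The lower and upper box-counting dimensions of $F$ are $$\underline{\dim}_B(F) = \liminf_{\delta \to 0^+} \frac{\log N_\delta (F)}{- \log \delta},\qquad \overline{\dim}_B(F) = \limsup_{\delta \to 0^+} \frac{\log N_\delta (F)}{- \log \delta}.$$ When these two are equal, their common value is the box-counting dimension $\dim_B(F)=\lim_{\delta\to 0^+}\frac{\log N_\delta(F)}{-\log\delta}$. The $\delta$-mesh triangles: consider the $\delta$-mesh squares $[m\delta,(m+1)\delta]\times[n\delta,(n+1)\delta]$ with $m,n\in\mathbb{Z}$. Each such square is cut along a diagonal (one diagonal being chosen for each square) into two closed right-angled isosceles triangles with shorter sides of length $\delta$ and longer side of length $\delta\sqrt{2}$. The collection of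 all these triangles, over all mesh squares, is the collection of $\delta$-mesh triangles, and $T_\delta(F)$ is the number of them that intersect $F$. (If $F$ is empty, the convention $\log 0=-\infty$ is used.) *)

theory Defs
  imports "HOL-Analysis.Analysis"
begin

text \<open>
  Logarithm of a counting number, with the convention \<open>log 0 = -\<infinity>\<close>; hence all dimensions
  below are extended reals, and the empty set has dimension \<open>-\<infinity>\<close>.
\<close>

definition log_count :: "nat \<Rightarrow> ereal" where
  "log_count k = (if k = 0 then -\<infinity> else ereal (ln (real k)))"

text \<open>Boxes are closed and axis-parallel, in arbitrary position (not only on the mesh).\<close>

definition boxes :: "real \<Rightarrow> 'a::euclidean_space set set" where
  "boxes \<delta> = {cbox a (a + \<delta> *\<^sub>R One) | a. True}"

text \<open>The minimum is over a non-empty set of numbers whenever \<open>F\<close> is bounded and \<open>\<delta> > 0\<close>.\<close>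

definition box_number :: "real \<Rightarrow> 'a::euclidean_space set \<Rightarrow> nat" where
  "box_number \<delta> F = (LEAST k. \<exists>\<C>. \<C> \<subseteq> boxes \<delta> \<and> finite \<C> \<and> card \<C> = k \<and> F \<subseteq> \<Union>\<C>)"

definition lower_box_dim :: "'a::euclidean_space set \<Rightarrow> ereal" where
  "lower_box_dim F = Liminf (at_right 0) (\<lambda>\<delta>. log_count (box_number \<delta> F) / ereal (- ln \<delta>))"

definition upper_box_dim :: "'a::euclidean_space set \<Rightarrow> ereal" where
  "upper_box_dim F = Limsup (at_right 0) (\<lambda>\<delta>. log_count (box_number \<delta> F) / ereal (- ln \<delta>))"

definition box_dim_exists :: "'a::euclidean_space set \<Rightarrow> bool" where
  "box_dim_exists F \<longleftrightarrow> lower_box_dim F = upper_box_dim F"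

definition box_dim :: "'a::euclidean_space set \<Rightarrow> ereal" where
  "box_dim F = (THE d. lower_box_dim F = d \<and> upper_box_dim F = d)"

lemma box_dim_tendsto:
  assumes "box_dim_exists F"
  shows "((\<lambda>\<delta>. log_count (box_number \<delta> F) / ereal (- ln \<delta>)) \<longlongrightarrow> box_dim F) (at_right 0)"
proof -
  have "box_dim F = lower_box_dim F"
    using assms unfolding box_dim_def box_dim_exists_def by auto
  with assms show ?thesis
    unfolding box_dim_exists_def lower_box_dim_def upper_box_dim_def
    by (intro Liminf_eq_Limsup) auto
qed

text \<open>\<open>Rising\<close> joins the lower left and upper right corners of a square, \<open>Falling\<close> the other two.\<close>

datatype diagonal = Rising | Falling

definition mesh_point :: "real \<Rightarrow> int \<Rightarrow> int \<Rightarrow> real ^ 2" where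
  "mesh_point \<delta> m n = vector [of_int m * \<delta>, of_int n * \<delta>]"

text \<open>
  The two closed triangles obtained by cutting
  \<open>[m\<delta>, (m+1)\<delta>] \<times> [n\<delta>, (n+1)\<delta>]\<close> along the given diagonal.
\<close>

fun square_triangles :: "diagonal \<Rightarrow> real \<Rightarrow> int \<Rightarrow> int \<Rightarrow> (real ^ 2) set set" where
  "square_triangles Rising \<delta> m n =
    {convex hull {mesh_point \<delta> m n, mesh_point \<delta> (m + 1) (n + 1), mesh_point \<delta> (m + 1) n},
     convex hull {mesh_point \<delta> m n, mesh_point \<delta> (m + 1) (n + 1), mesh_point \<delta> m (n + 1)}}"
| "square_triangles Falling \<delta> m n =
    {convex hull {mesh_point \<delta> (m + 1) n, mesh_point \<delta> m (n + 1), mesh_point \<delta> m n},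
     convex hull {mesh_point \<delta> (m + 1) n, mesh_point \<delta> m (n + 1), mesh_point \<delta> (m + 1) (n + 1)}}"

definition mesh_triangles :: "(int \<Rightarrow> int \<Rightarrow> diagonal) \<Rightarrow> real \<Rightarrow> (real ^ 2) set set" where
  "mesh_triangles D \<delta> = (\<Union>m n. square_triangles (D m n) \<delta> m n)"

definition triangle_number ::
    "(int \<Rightarrow> int \<Rightarrow> diagonal) \<Rightarrow> real \<Rightarrow> (real ^ 2) set \<Rightarrow> nat" where
  "triangle_number D \<delta> F = card {t \<in> mesh_triangles D \<delta>. t \<inter> F \<noteq> {}}"

end

theory Submission
  imports Defs
begin

text \<open>
  At every scale \<open>N \<le> T \<le> 18 N\<close>: every mesh triangle lies in a box of side \<open>\<delta>\<close>, and a closed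
  box of side \<open>\<delta>\<close> meets at most \<open>3 \<times> 3\<close> mesh squares, hence at most \<open>18\<close> mesh triangles.
  The constant disappears after division by \<open>- ln \<delta>\<close>.
\<close>

section \<open>Covers by closed boxes\<close>

text \<open>By compactness of \<open>closure F\<close>, finitely many open cubes centred at its
  points cover it; their closures are boxes of side \<open>\<delta>\<close>. Thus
  \<open>LEAST\<close> in \<open>box_number\<close> ranges over a nonempty set.\<close>

lemma finite_box_cover:
  fixes F :: "'a::euclidean_space set"
  assumes "bounded F" and "\<delta> > 0"
  obtains \<C> where "\<C> \<subseteq> boxes \<delta>" "finite \<C>" "F \<subseteq> \<Union>\<C>"
proof -
  define U :: "'a \<Rightarrow> 'a set" where
    "U x = box (x - (\<delta>/2) *\<^sub>R One) (x + (\<delta>/2) *\<^sub>R One)" for x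
  have "x \<in> U x" for x
    using \<open>\<delta> > 0\<close> by (auto simp: U_def mem_box inner_diff_left inner_add_left)
  then have "closure F \<subseteq> (\<Union>x\<in>closure F. U x)" by blast
  moreover have "compact (closure F)" using assms(1) by simp
  ultimately obtain X where X: "X \<subseteq> closure F" "finite X" "closure F \<subseteq> (\<Union>x\<in>X. U x)"
    using compactE_image[of "closure F" "closure F" U] by (auto simp: U_def)
  \<comment> \<open>The closed version of \<open>U x\<close>, written as lower corner plus side to
    match the form in \<open>boxes\<close>.\<close>
  define V :: "'a \<Rightarrow> 'a set" where
    "V x = cbox (x - (\<delta>/2) *\<^sub>R One) (x - (\<delta>/2) *\<^sub>R One + \<delta> *\<^sub>R One)" for x
  have eq: "x - (\<delta>/2) *\<^sub>R One + \<delta> *\<^sub>R One = x + (\<delta>/2) *\<^sub>R One" for x :: 'a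
  proof -
    have "\<delta> *\<^sub>R (One :: 'a) = (\<delta>/2) *\<^sub>R One + (\<delta>/2) *\<^sub>R One"
      by (simp flip: scaleR_add_left)
    then show ?thesis by simp
  qed
  have "U x \<subseteq> V x" for x
    unfolding U_def V_def eq by (rule box_subset_cbox)
  then have "F \<subseteq> \<Union>(V ` X)"
    using X(3) closure_subset[of F] by blast
  moreover have "V ` X \<subseteq> boxes \<delta>" by (auto simp: V_def boxes_def)
  ultimately show ?thesis using that X(2) by blast
qed

lemma box_number_le:
  assumes "\<C> \<subseteq> boxes \<delta>" "finite \<C>" "F \<subseteq> \<Union>\<C>"
  shows "box_number \<delta> F \<le> card \<C>"
  unfolding box_number_def by (rule Least_le) (use assms in blast)

lemma minimal_box_cover:
  assumes "bounded F" and "\<delta> > 0"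
  obtains \<C> where "\<C> \<subseteq> boxes \<delta>" "finite \<C>" "card \<C> = box_number \<delta> F" "F \<subseteq> \<Union>\<C>"
proof -
  obtain \<C> where "\<C> \<subseteq> boxes \<delta>" "finite \<C>" "F \<subseteq> \<Union>\<C>"
    using finite_box_cover[OF assms] .
  then have "\<exists>k. \<exists>\<C>. \<C> \<subseteq> boxes \<delta> \<and> finite \<C> \<and> card \<C> = k \<and> F \<subseteq> \<Union>\<C>" by blast
  from LeastI_ex[OF this] show ?thesis using that unfolding box_number_def by blast
qed

section \<open>Geometry of the mesh triangles\<close>

lemma mem_box_vec2:
  fixes a x :: "real ^ 2"
  shows "x \<in> cbox a (a + \<delta> *\<^sub>R One) \<longleftrightarrow>
    a $ 1 \<le> x $ 1 \<and> x $ 1 \<le> a $ 1 + \<delta> \<and> a $ 2 \<le> x $ 2 \<and> x $ 2 \<le> a $ 2 + \<delta>"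
proof -
  \<comment> \<open>Each coordinate is the inner product with a basis vector, and \<open>One\<close>
    is the sum of the basis.\<close>
  have "(One :: real ^ 2) $ i = 1" for i
    by (simp add: cart_eq_inner_axis axis_in_Basis_iff inner_sum_left_Basis del: inner_axis)
  then show ?thesis by (auto simp: mem_box_cart forall_2)
qed

lemma mesh_point_nth [simp]:
  "mesh_point \<delta> m n $ 1 = of_int m * \<delta>" "mesh_point \<delta> m n $ 2 = of_int n * \<delta>"
  by (simp_all add: mesh_point_def)

text \<open>The vertices are corners of the mesh square, which is convex and so contains their
  hull.\<close>

lemma square_triangle_subset_box:
  assumes "t \<in> square_triangles d \<delta> m n" and "\<delta> > 0"
  shows "t \<subseteq> cbox (mesh_point \<delta> m n) (mesh_point \<delta> m n + \<delta> *\<^sub>R One)"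
proof -
  let ?B = "cbox (mesh_point \<delta> m n) (mesh_point \<delta> m n + \<delta> *\<^sub>R One)"
  let ?V = "{mesh_point \<delta> m n, mesh_point \<delta> (m + 1) n, mesh_point \<delta> m (n + 1),
    mesh_point \<delta> (m + 1) (n + 1)}"
  obtain V where t: "t = convex hull V" and "V \<subseteq> ?V"
    using assms(1) by (cases d) auto
  note this(2)
  also have "?V \<subseteq> ?B"
    using assms(2) by (simp add: mem_box_vec2 algebra_simps)
  finally show ?thesis unfolding t by (intro hull_minimal convex_box)
qed

lemma mem_convex_hull_3I:
  assumes "0 \<le> u" "0 \<le> v" "0 \<le> w" "u + v + w = 1" "x = u *\<^sub>R a + v *\<^sub>R b + w *\<^sub>R c"
  shows "x \<in> convex hull {a, b, c}"
  using assms unfolding convex_hull_3 by blast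

text \<open>In coordinates relative to the square and scaled by \<open>\<delta>\<close>, the
  diagonal is v = u (\<open>Rising\<close>) or u + v = 1 (\<open>Falling\<close>). The side on which
  the point lies decides the triangle.\<close>

lemma square_triangles_cover_box:
  assumes "x \<in> cbox (mesh_point \<delta> m n) (mesh_point \<delta> m n + \<delta> *\<^sub>R One)" and "\<delta> > 0"
  shows "\<exists>t\<in>square_triangles d \<delta> m n. x \<in> t"
proof -
  define u v where "u = x $ 1 / \<delta> - m" and "v = x $ 2 / \<delta> - n"
  have x: "x $ 1 = (m + u) * \<delta>" "x $ 2 = (n + v) * \<delta>"
    using assms(2) by (simp_all add: u_def v_def)
  have uv: "0 \<le> u" "u \<le> 1" "0 \<le> v" "v \<le> 1"
    using assms unfolding mem_box_vec2 by (simp_all add: u_def v_def field_simps)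
  show ?thesis
  proof (cases d)
    case Rising
    show ?thesis
    proof (cases "v \<le> u")
      case True
      then have "x \<in> convex hull {mesh_point \<delta> m n, mesh_point \<delta> (m + 1) (n + 1), mesh_point \<delta> (m + 1) n}"
        \<comment> \<open>The weights are barycentric coordinates, here from (u, v) = (1 - u)(0, 0)
          + v(1, 1) + (u - v)(1, 0). The case condition makes the last weight nonnegative; the other
          three cases are analogous.\<close>
        using uv by (intro mem_convex_hull_3I[of "1 - u" v "u - v"])
          (auto simp: vec_eq_iff forall_2 x algebra_simps)
      then show ?thesis using Rising by simp
    next
      case False
      then have "x \<in> convex hull {mesh_point \<delta> m n, mesh_point \<delta> (m + 1) (n + 1), mesh_point \<delta> m (n + 1)}"
        using uv by (intro mem_convex_hull_3I[of "1 - v" u "v - u"])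
          (auto simp: vec_eq_iff forall_2 x algebra_simps)
      then show ?thesis using Rising by simp
    qed
  next
    case Falling
    show ?thesis
    proof (cases "u + v \<le> 1")
      case True
      then have "x \<in> convex hull {mesh_point \<delta> (m + 1) n, mesh_point \<delta> m (n + 1), mesh_point \<delta> m n}"
        using uv by (intro mem_convex_hull_3I[of u v "1 - u - v"])
          (auto simp: vec_eq_iff forall_2 x algebra_simps)
      then show ?thesis using Falling by simp
    next
      case False
      then have "x \<in> convex hull {mesh_point \<delta> (m + 1) n, mesh_point \<delta> m (n + 1), mesh_point \<delta> (m + 1) (n + 1)}"
        using uv by (intro mem_convex_hull_3I[of "1 - v" "1 - u" "u + v - 1"])
          (auto simp: vec_eq_iff forall_2 x algebra_simps)
      then show ?thesis using Falling by simp
    qed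
  qed
qed

lemma mesh_triangles_cover:
  assumes "\<delta> > 0"
  shows "\<exists>t\<in>mesh_triangles D \<delta>. x \<in> t"
proof -
  \<comment> \<open>The floors select one mesh square containing \<open>x\<close>, even when
    \<open>x\<close> lies on a common edge.\<close>
  define m n where "m = \<lfloor>x $ 1 / \<delta>\<rfloor>" and "n = \<lfloor>x $ 2 / \<delta>\<rfloor>"
  have "of_int m \<le> x $ 1 / \<delta>" "x $ 1 / \<delta> \<le> of_int m + 1"
    "of_int n \<le> x $ 2 / \<delta>" "x $ 2 / \<delta> \<le> of_int n + 1"
    unfolding m_def n_def by linarith+
  then have "x \<in> cbox (mesh_point \<delta> m n) (mesh_point \<delta> m n + \<delta> *\<^sub>R One)"
    using assms unfolding mem_box_vec2 by (simp add: field_simps)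
  from square_triangles_cover_box[OF this assms, of "D m n"] show ?thesis
    unfolding mesh_triangles_def by blast
qed

lemma mesh_triangle_subset_box:
  assumes "t \<in> mesh_triangles D \<delta>" and "\<delta> > 0"
  shows "\<exists>b\<in>boxes \<delta>. t \<subseteq> b"
proof -
  obtain m n where "t \<in> square_triangles (D m n) \<delta> m n"
    using assms(1) unfolding mesh_triangles_def by blast
  from square_triangle_subset_box[OF this assms(2)] show ?thesis
    unfolding boxes_def by blast
qed

text \<open>An upper bound suffices for the counting, so the two hulls are not shown to be
  distinct.\<close>

lemma finite_card_square_triangles: "finite (square_triangles d \<delta> m n)" "card (square_triangles d \<delta> m n) \<le> 2"
  by (cases d; simp add: card_insert_if)+

lemma mesh_triangles_meeting_box:
  assumes "b \<in> boxes \<delta>" and "\<delta> > 0"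
  shows "finite {t \<in> mesh_triangles D \<delta>. t \<inter> b \<noteq> {}}" (is "finite ?T")
    and "card {t \<in> mesh_triangles D \<delta>. t \<inter> b \<noteq> {}} \<le> 18"
proof -
  obtain a where b: "b = cbox a (a + \<delta> *\<^sub>R One)"
    using assms(1) unfolding boxes_def by blast
  \<comment> \<open>If the closed intervals from a to a + \<delta> and from k\<delta> to (k +
    1)\<delta> meet, then k differs from a/\<delta> by at most 1. This leaves three integers around
    the floor, and all three occur when a/\<delta> is an integer.\<close>
  define I where "I i = {\<lfloor>a $ i / \<delta>\<rfloor> - 1 .. \<lfloor>a $ i / \<delta>\<rfloor> + 1}" for i
  define R where "R = (\<Union>(m, n)\<in>I 1 \<times> I 2. square_triangles (D m n) \<delta> m n)"
  have *: "k \<in> I i"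
    if "a $ i \<le> y" "y \<le> a $ i + \<delta>" "of_int k * \<delta> \<le> y" "y \<le> of_int k * \<delta> + \<delta>" for k i y
  proof -
    have "of_int k * \<delta> \<le> a $ i + \<delta>" "a $ i \<le> of_int k * \<delta> + \<delta>" using that by linarith+
    then have "of_int k \<le> a $ i / \<delta> + 1" "a $ i / \<delta> \<le> of_int k + 1"
      using assms(2) by (simp_all add: field_simps)
    then show ?thesis unfolding I_def by simp linarith
  qed
  have "?T \<subseteq> R"
  proof
    fix t assume "t \<in> ?T"
    then obtain m n x where t: "t \<in> square_triangles (D m n) \<delta> m n" and x: "x \<in> t" "x \<in> b"
      unfolding mesh_triangles_def by blast
    have "x \<in> cbox (mesh_point \<delta> m n) (mesh_point \<delta> m n + \<delta> *\<^sub>R One)"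
      using square_triangle_subset_box[OF t assms(2)] x by blast
    then have "m \<in> I 1" "n \<in> I 2"
      using x(2) *[of 1 "x $ 1" m] *[of 2 "x $ 2" n] unfolding b mem_box_vec2 by auto
    with t show "t \<in> R" unfolding R_def by blast
  qed
  moreover have "finite R"
    unfolding R_def by (auto simp: I_def finite_card_square_triangles)
  moreover have "card R \<le> 18"
  proof -
    have "card R \<le> (\<Sum>(m, n)\<in>I 1 \<times> I 2. card (square_triangles (D m n) \<delta> m n))"
      using card_UN_le[of "I 1 \<times> I 2" "\<lambda>(m, n). square_triangles (D m n) \<delta> m n"]
      by (simp add: R_def I_def case_prod_unfold)
    also have "\<dots> \<le> (\<Sum>(m, n)\<in>I 1 \<times> I 2. 2)"
      by (intro sum_mono) (auto simp: finite_card_square_triangles)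
    \<comment> \<open>Nine index pairs, two triangles each.\<close>
    also have "\<dots> = 18" by (simp add: I_def case_prod_unfold)
    finally show ?thesis .
  qed
  ultimately show "finite ?T" "card ?T \<le> 18"
    by (auto intro: finite_subset order_trans[OF card_mono])
qed

section \<open>Comparison of the two counts\<close>

lemma triangle_number_bounds:
  assumes "bounded F" and "\<delta> > 0"
  shows "box_number \<delta> F \<le> triangle_number D \<delta> F"
    and "triangle_number D \<delta> F \<le> 18 * box_number \<delta> F"
proof -
  let ?T = "\<lambda>A. {t \<in> mesh_triangles D \<delta>. t \<inter> A \<noteq> {}}"
  obtain \<C> where \<C>: "\<C> \<subseteq> boxes \<delta>" "finite \<C>" "card \<C> = box_number \<delta> F" "F \<subseteq> \<Union>\<C>"
    using minimal_box_cover[OF assms] .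
  have sub: "?T F \<subseteq> (\<Union>b\<in>\<C>. ?T b)" using \<C>(4) by blast
  \<comment> \<open>Finiteness has to come first: \<open>card\<close> of an infinite set is 0, so
    inclusion alone does not bound cardinalities.\<close>
  have fin: "finite (\<Union>b\<in>\<C>. ?T b)"
    using \<C>(1,2) mesh_triangles_meeting_box(1)[OF _ assms(2)] by blast
  have "card (?T F) \<le> card (\<Union>b\<in>\<C>. ?T b)" by (rule card_mono[OF fin sub])
  also have "\<dots> \<le> (\<Sum>b\<in>\<C>. card (?T b))" by (rule card_UN_le[OF \<C>(2)])
  also have "\<dots> \<le> (\<Sum>b\<in>\<C>. 18)"
    using \<C>(1) assms(2) by (intro sum_mono mesh_triangles_meeting_box(2)) auto
  finally show "triangle_number D \<delta> F \<le> 18 * box_number \<delta> F"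
    using \<C>(3) by (simp add: triangle_number_def)
  \<comment> \<open>Choosing a box around each triangle turns the triangles that meet
    \<open>F\<close> into a box cover of \<open>F\<close>. Several triangles may share a box, which
    only lowers the count.\<close>
  obtain B where B: "\<And>t. t \<in> mesh_triangles D \<delta> \<Longrightarrow> B t \<in> boxes \<delta> \<and> t \<subseteq> B t"
    using mesh_triangle_subset_box[OF _ assms(2)] by metis
  have finT: "finite (?T F)" using finite_subset[OF sub fin] .
  have "F \<subseteq> \<Union>(B ` ?T F)"
    using mesh_triangles_cover[OF assms(2)] B by blast
  then have "box_number \<delta> F \<le> card (B ` ?T F)"
    using B finT by (intro box_number_le) auto
  also have "\<dots> \<le> card (?T F)" by (rule card_image_le[OF finT])
  finally show "box_number \<delta> F \<le> triangle_number D \<delta> F"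
    by (simp add: triangle_number_def)
qed

section \<open>Logarithms and limits\<close>

lemma log_count_mono: "j \<le> k \<Longrightarrow> log_count j \<le> log_count k"
  by (simp add: log_count_def)

text \<open>For \<open>k = 0\<close> both sides are \<open>-\<infinity>\<close>, so the sum formula
  has no exception.\<close>

lemma log_count_mult: "c > 0 \<Longrightarrow> log_count (c * k) = log_count k + ereal (ln c)"
  by (simp add: log_count_def ln_mult)

text \<open>The factor \<open>c\<close> adds at most ln c / (- ln \<delta>) to the quotient, which
  tends to 0. Comparing up to an additive \<open>e\<close> avoids subtracting quotients that may be
  \<open>-\<infinity>\<close>.\<close>

lemma Liminf_Limsup_log_count_cong:
  fixes f g :: "real \<Rightarrow> nat"
  assumes "\<And>\<delta>. \<delta> > 0 \<Longrightarrow> f \<delta> \<le> g \<delta>" and "\<And>\<delta>. \<delta> > 0 \<Longrightarrow> g \<delta> \<le> c * f \<delta>" and "c > 0"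
  defines "q \<equiv> \<lambda>f \<delta>. log_count (f \<delta>) / ereal (- ln \<delta>)"
  shows "Liminf (at_right 0) (q f) = Liminf (at_right 0) (q g)"
    and "Limsup (at_right 0) (q f) = Limsup (at_right 0) (q g)"
proof -
  \<comment> \<open>Below 1 the denominator \<open>- ln \<delta>\<close> is positive, so division by
    it preserves inequalities.\<close>
  have ev: "eventually (\<lambda>\<delta>::real. 0 < \<delta> \<and> \<delta> < 1) (at_right 0)"
    by (simp add: eventually_at_right_field) (use zero_less_one in blast)
  have lower: "eventually (\<lambda>\<delta>. q f \<delta> \<le> q g \<delta>) (at_right 0)"
    using ev
  proof eventually_elim
    case (elim \<delta>)
    then show ?case
      unfolding q_def using assms(1) by (intro ereal_divide_right_mono log_count_mono) auto
  qed
  have upper: "eventually (\<lambda>\<delta>. q g \<delta> \<le> q f \<delta> + ereal e) (at_right 0)" if "e > 0" for e :: real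
  proof -
    have "((\<lambda>\<delta>. ln (real c) / - ln \<delta>) \<longlongrightarrow> 0) (at_right 0)"
      by (intro real_tendsto_divide_at_top[OF tendsto_const])
        (use ln_at_0 in \<open>simp add: filterlim_uminus_at_top\<close>)
    then have "eventually (\<lambda>\<delta>. ln (real c) / - ln \<delta> < e) (at_right 0)"
      using that by (rule order_tendstoD)
    then show ?thesis using ev
    proof eventually_elim
      case (elim \<delta>)
      then have pos: "- ln \<delta> > 0" by simp
      have "q g \<delta> \<le> log_count (c * f \<delta>) / ereal (- ln \<delta>)"
        unfolding q_def using assms(2) elim pos
        by (intro ereal_divide_right_mono log_count_mono) auto
      also have "\<dots> = q f \<delta> + ereal (ln (real c) / - ln \<delta>)"
        using pos assms(3) unfolding q_def log_count_mult[OF assms(3)]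
        by (cases "f \<delta> = 0") (simp_all add: log_count_def add_divide_distrib)
      also have "\<dots> \<le> q f \<delta> + ereal e"
        using elim by (intro add_left_mono) simp
      finally show ?case .
    qed
  qed
  show "Liminf (at_right 0) (q f) = Liminf (at_right 0) (q g)"
  proof (rule antisym)
    show "Liminf (at_right 0) (q g) \<le> Liminf (at_right 0) (q f)"
    \<comment> \<open>A finite constant can be pulled out of \<open>Liminf\<close>, infinite values
      included; then \<open>e\<close> is arbitrary.\<close>
    proof (rule ereal_le_epsilon2)
      fix e :: real assume "0 < e"
      from Liminf_mono[OF upper[OF this]]
      show "Liminf (at_right 0) (q g) \<le> Liminf (at_right 0) (q f) + ereal e"
        by (simp add: Liminf_add_ereal_right)
    qed
  qed (rule Liminf_mono[OF lower])
  show "Limsup (at_right 0) (q f) = Limsup (at_right 0) (q g)"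
  proof (rule antisym)
    show "Limsup (at_right 0) (q g) \<le> Limsup (at_right 0) (q f)"
    proof (rule ereal_le_epsilon2)
      fix e :: real assume "0 < e"
      from Limsup_mono[OF upper[OF this]]
      show "Limsup (at_right 0) (q g) \<le> Limsup (at_right 0) (q f) + ereal e"
        by (simp add: Limsup_add_ereal_right)
    qed
  qed (rule Limsup_mono[OF lower])
qed

text \<open>The count bounds hold at each scale for any diagonals, so the diagonals may be chosen
  anew for every \<open>\<delta>\<close>. The limit \<open>L\<close> is an extended real, which
  covers \<open>-\<infinity>\<close> for empty \<open>F\<close>.\<close>

theorem theorem2p1:
  fixes F :: "(real ^ 2) set"
    and D :: "real \<Rightarrow> int \<Rightarrow> int \<Rightarrow> diagonal"
  assumes "bounded F"
  shows "lower_box_dim F =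
           Liminf (at_right 0) (\<lambda>\<delta>. log_count (triangle_number (D \<delta>) \<delta> F) / ereal (- ln \<delta>))
       \<and> upper_box_dim F =
           Limsup (at_right 0) (\<lambda>\<delta>. log_count (triangle_number (D \<delta>) \<delta> F) / ereal (- ln \<delta>))
       \<and> (\<forall>L. ((\<lambda>\<delta>. log_count (triangle_number (D \<delta>) \<delta> F) / ereal (- ln \<delta>)) \<longlongrightarrow> L) (at_right 0)
              \<longrightarrow> box_dim_exists F \<and> box_dim F = L)"
proof -
  let ?q = "\<lambda>\<delta>. log_count (triangle_number (D \<delta>) \<delta> F) / ereal (- ln \<delta>)"
  note eqs = Liminf_Limsup_log_count_cong[of "\<lambda>\<delta>. box_number \<delta> F"
    "\<lambda>\<delta>. triangle_number (D \<delta>) \<delta> F" 18, OF triangle_number_bounds[OF assms]]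
  have low: "lower_box_dim F = Liminf (at_right 0) ?q"
    unfolding lower_box_dim_def by (rule eqs) auto
  have upp: "upper_box_dim F = Limsup (at_right 0) ?q"
    unfolding upper_box_dim_def by (rule eqs) auto
  have "box_dim_exists F \<and> box_dim F = L" if "(?q \<longlongrightarrow> L) (at_right 0)" for L
  proof -
    \<comment> \<open>Convergence along the nontrivial filter \<open>at_right 0\<close> makes
      \<open>Liminf\<close> and \<open>Limsup\<close> both equal to \<open>L\<close>.\<close>
    have "lower_box_dim F = L" "upper_box_dim F = L"
      using that by (simp_all add: low upp lim_imp_Liminf lim_imp_Limsup)
    then show ?thesis by (simp add: box_dim_exists_def box_dim_def)
  qed
  with low upp show ?thesis by blast
qed

end
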